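(* Let $f:\overline{\mathbb{B}}\to\mathbb{H}$ be a function that is slice regular on the open unit ball $\mathbb{B}$, with power series expansion $f(q)=\sum_{n\geq 0}q^n a_n$ for $q\in\mathbb{B}$ ($a_n\in\mathbb{H}$), continuous on the closure $\overline{\mathbb{B}}$, and such that $|f(q)|<1$ for all $|q|\leq 1$. Then $$\sum_{n\geq 0}|q^n a_n|<1$$ for all $q\in\mathbb{H}$ with $|q|\leq\frac13$. Moreover, $\frac13$ is the largest radius for which this statement is true: for every real $\rho>\frac13$ there exist a function $f:\overline{\mathbb{B}}\to\mathbb{H}$ that is slice regular on $\mathbb{B}$, with power series expansion $f(p)=\sum_{n\geq 0}p^n a_n$ for $p\in\mathbb{B}$ ($a_n\in\mathbb{H}$), continuous on $\overline{\mathbb{B}}$, and such that $|f(p)|<1$ for all $|p|\leq 1$, and a point $q\in\mathbb{H}$ with $|q|\leq\rho$ such that the inequality $\sum_{n\geq 0}|q^n a_n|<1$ fails.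
   Context: $\mathbb{H}$ denotes the skew field of quaternions with its usual modulus $|\cdot|$, and $\mathbb{B}=\{q\in\mathbb{H} : |q|<1\}$. $\mathbb{S}=\{q\in\mathbb{H} : q^2=-1\}$ is the 2-sphere of imaginary units; for $I\in\mathbb{S}$, $L_I=\mathbb{R}+I\mathbb{R}$, and for $\Omega\subset\mathbb{H}$, $\Omega_I=\Omega\cap L_I$. Slice regularity: let $\Omega$ be a domain in $\mathbb{H}$. A function $f:\Omega\to\mathbb{H}$ is slice regular if, for every $I\in\mathbb{S}$, its restriction $f_I$ to $\Omega_I$ has continuous partial derivatives and satisfies $$\frac12\Big(\frac{\partial}{\partial x}+I\frac{\partial}{\partial y}\Big)f_I(x+yI)=0$$ for every $x+yI\in\Omega_I$. It is known that a function is slice regular on a ball $\{q\in\mathbb{H} : |q|<R\}$ if and only if it has there a convergent power series expansion $f(q)=\sum_{n\geq0}q^n a_n$ with coefficients $a_n\in\mathbb{H}$ on the right, $a_n=\frac{1}{n!}\frac{\partial^n f}{\partial x^n}(0)$ (derivatives in the real direction). *)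

theory Defs
  imports "HOL-Analysis.Analysis"
begin

section \<open>The skew field of quaternions\<close>

text \<open>\<open>Quat a b c d\<close> stands for $a + bi + cj + dk$.\<close>

datatype quat = Quat (qRe: real) (qI: real) (qJ: real) (qK: real)

lemma quat_eq_iff: "p = q \<longleftrightarrow> qRe p = qRe q \<and> qI p = qI q \<and> qJ p = qJ q \<and> qK p = qK q"
  by (cases p; cases q) auto

instantiation quat :: ring_1
begin

definition zero_quat :: quat where "0 = Quat 0 0 0 0"

definition one_quat :: quat where "1 = Quat 1 0 0 0"

definition plus_quat :: "quat \<Rightarrow> quat \<Rightarrow> quat" where
  "p + q = Quat (qRe p + qRe q) (qI p + qI q) (qJ p + qJ q) (qK p + qK q)"

definition uminus_quat :: "quat \<Rightarrow> quat" where
  "- p = Quat (- qRe p) (- qI p) (- qJ p) (- qK p)"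

definition minus_quat :: "quat \<Rightarrow> quat \<Rightarrow> quat" where
  "p - q = Quat (qRe p - qRe q) (qI p - qI q) (qJ p - qJ q) (qK p - qK q)"

definition times_quat :: "quat \<Rightarrow> quat \<Rightarrow> quat" where
  "p * q = Quat
     (qRe p * qRe q - qI p * qI q - qJ p * qJ q - qK p * qK q)
     (qRe p * qI q + qI p * qRe q + qJ p * qK q - qK p * qJ q)
     (qRe p * qJ q - qI p * qK q + qJ p * qRe q + qK p * qI q)
     (qRe p * qK q + qI p * qJ q - qJ p * qI q + qK p * qRe q)"

lemma quat_sel_simps [simp]:
  "qRe 0 = 0" "qI 0 = 0" "qJ 0 = 0" "qK 0 = 0"
  "qRe 1 = 1" "qI 1 = 0" "qJ 1 = 0" "qK 1 = 0"
  "qRe (p + q) = qRe p + qRe q" "qI (p + q) = qI p + qI q"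
  "qJ (p + q) = qJ p + qJ q" "qK (p + q) = qK p + qK q"
  "qRe (- p) = - qRe p" "qI (- p) = - qI p" "qJ (- p) = - qJ p" "qK (- p) = - qK p"
  "qRe (p - q) = qRe p - qRe q" "qI (p - q) = qI p - qI q"
  "qJ (p - q) = qJ p - qJ q" "qK (p - q) = qK p - qK q"
  "qRe (p * q) = qRe p * qRe q - qI p * qI q - qJ p * qJ q - qK p * qK q"
  "qI (p * q) = qRe p * qI q + qI p * qRe q + qJ p * qK q - qK p * qJ q"
  "qJ (p * q) = qRe p * qJ q - qI p * qK q + qJ p * qRe q + qK p * qI q"
  "qK (p * q) = qRe p * qK q + qI p * qJ q - qJ p * qI q + qK p * qRe q"
  by (simp_all add: zero_quat_def one_quat_def plus_quat_def uminus_quat_def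
      minus_quat_def times_quat_def)

instance
  by standard (simp_all add: quat_eq_iff algebra_simps)

end

instantiation quat :: real_algebra_1
begin

definition scaleR_quat :: "real \<Rightarrow> quat \<Rightarrow> quat" where
  "r *\<^sub>R q = Quat (r * qRe q) (r * qI q) (r * qJ q) (r * qK q)"

lemma quat_sel_scaleR [simp]:
  "qRe (r *\<^sub>R q) = r * qRe q" "qI (r *\<^sub>R q) = r * qI q"
  "qJ (r *\<^sub>R q) = r * qJ q" "qK (r *\<^sub>R q) = r * qK q"
  by (simp_all add: scaleR_quat_def)

instance
  by standard (simp_all add: quat_eq_iff algebra_simps)

end

instantiation quat :: real_inner
begin

definition inner_quat :: "quat \<Rightarrow> quat \<Rightarrow> real" where
  "p \<bullet> q = qRe p * qRe q + qI p * qI q + qJ p * qJ q + qK p * qK q"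

definition norm_quat :: "quat \<Rightarrow> real" where
  "norm q = sqrt ((qRe q)\<^sup>2 + (qI q)\<^sup>2 + (qJ q)\<^sup>2 + (qK q)\<^sup>2)"

definition sgn_quat :: "quat \<Rightarrow> quat" where
  "sgn q = q /\<^sub>R norm q" for q :: quat

definition dist_quat :: "quat \<Rightarrow> quat \<Rightarrow> real" where
  "dist p q = norm (p - q)" for p q :: quat

definition uniformity_quat :: "(quat \<times> quat) filter" where
  "(uniformity :: (quat \<times> quat) filter) = (INF e\<in>{0<..}. principal {(x, y). dist x y < e})"

definition open_quat :: "quat set \<Rightarrow> bool" where
  "open U \<longleftrightarrow> (\<forall>x\<in>U. eventually (\<lambda>(x', y). x' = x \<longrightarrow> y \<in> U) uniformity)" for U :: "quat set"

instance
proof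
  fix p q r :: quat and a :: real and U :: "quat set"
  show "dist p q = norm (p - q)" by (rule dist_quat_def)
  show "sgn q = q /\<^sub>R norm q" by (rule sgn_quat_def)
  show "(uniformity :: (quat \<times> quat) filter)
      = (INF e\<in>{0<..}. principal {(x, y). dist x y < e})" by (rule uniformity_quat_def)
  show "open U \<longleftrightarrow> (\<forall>x\<in>U. eventually (\<lambda>(x', y). x' = x \<longrightarrow> y \<in> U) uniformity)"
    by (rule open_quat_def)
  show "p \<bullet> q = q \<bullet> p" by (simp add: inner_quat_def algebra_simps)
  show "(p + q) \<bullet> r = p \<bullet> r + q \<bullet> r" by (simp add: inner_quat_def algebra_simps)
  show "(a *\<^sub>R p) \<bullet> q = a * (p \<bullet> q)" by (simp add: inner_quat_def algebra_simps)
  show "0 \<le> p \<bullet> p" by (simp add: inner_quat_def)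
  show "p \<bullet> p = 0 \<longleftrightarrow> p = 0"
    by (simp add: inner_quat_def quat_eq_iff add_nonneg_eq_0_iff)
  show "norm p = sqrt (p \<bullet> p)"
    by (simp add: inner_quat_def norm_quat_def power2_eq_square)
qed

end

instantiation quat :: real_normed_div_algebra
begin

definition inverse_quat :: "quat \<Rightarrow> quat" where
  "inverse q = Quat (qRe q) (- qI q) (- qJ q) (- qK q) /\<^sub>R (norm q)\<^sup>2"

definition divide_quat :: "quat \<Rightarrow> quat \<Rightarrow> quat" where
  "p div q = p * inverse q" for p q :: quat

instance
proof
  fix p q :: quat
  have n2: "(norm r)\<^sup>2 = (qRe r)\<^sup>2 + (qI r)\<^sup>2 + (qJ r)\<^sup>2 + (qK r)\<^sup>2" for r :: quat
    by (simp add: norm_quat_def)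
  show "p div q = p * inverse q" by (rule divide_quat_def)
  show "inverse (0 :: quat) = 0"
    by (simp add: inverse_quat_def quat_eq_iff)
  have inv: "inverse q * q = 1 \<and> q * inverse q = 1" if "q \<noteq> 0"
  proof -
    define c where "c = Quat (qRe q) (- qI q) (- qJ q) (- qK q)"
    have "c * q = (norm q)\<^sup>2 *\<^sub>R 1" "q * c = (norm q)\<^sup>2 *\<^sub>R 1"
      unfolding n2 by (simp_all add: c_def quat_eq_iff power2_eq_square)
    moreover have "inverse q = c /\<^sub>R (norm q)\<^sup>2"
      by (simp add: inverse_quat_def c_def)
    ultimately show ?thesis
      using that by simp
  qed
  show "inverse q * q = 1" if "q \<noteq> 0" using inv that by blast
  show "q * inverse q = 1" if "q \<noteq> 0" using inv that by blast
  have "(norm (p * q))\<^sup>2 = (norm p * norm q)\<^sup>2"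
    unfolding power_mult_distrib n2 quat_sel_simps by algebra
  then show "norm (p * q) = norm p * norm q"
    by (simp add: power2_eq_iff_nonneg)
qed

end

instantiation quat :: euclidean_space
begin

definition Basis_quat :: "quat set" where
  "Basis = {Quat 1 0 0 0, Quat 0 1 0 0, Quat 0 0 1 0, Quat 0 0 0 1}"

instance
proof
  show "(Basis :: quat set) \<noteq> {}"
    by (simp add: Basis_quat_def)
  show "finite (Basis :: quat set)"
    by (simp add: Basis_quat_def)
  show "u \<bullet> v = (if u = v then 1 else 0)" if "u \<in> Basis" "v \<in> Basis" for u v :: quat
    using that unfolding Basis_quat_def inner_quat_def by (elim insertE emptyE) simp_all
  show "(\<forall>u\<in>Basis. x \<bullet> u = 0) \<longleftrightarrow> x = 0" for x :: quat
    unfolding Basis_quat_def quat_eq_iff[of x] by (simp add: inner_quat_def)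
qed

end


section \<open>Slice regular functions\<close>

definition imag_units :: "quat set" where
  "imag_units = {q. q\<^sup>2 = -1}"

text \<open>
  \<open>slice_coords I \<Omega>\<close> is $\Omega_I = \Omega \cap (\mathbb{R} + I\mathbb{R})$, seen in the real
  coordinates $(x,y) \mapsto x + yI$.
\<close>

definition slice_coords :: "quat \<Rightarrow> quat set \<Rightarrow> (real \<times> real) set" where
  "slice_coords I \<Omega> = {(x, y). of_real x + of_real y * I \<in> \<Omega>}"

text \<open>
  The functions \<open>fx\<close> and \<open>fy\<close> are the partial derivatives of
  $(x,y) \mapsto f_I(x+yI)$; they are determined on \<open>slice_coords I \<Omega>\<close> since \<open>\<Omega>\<close> is open.
\<close>

definition slice_regular_on :: "(quat \<Rightarrow> quat) \<Rightarrow> quat set \<Rightarrow> bool" where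
  "slice_regular_on f \<Omega> \<longleftrightarrow>
     open \<Omega> \<and> connected \<Omega> \<and> \<Omega> \<noteq> {} \<and>
     (\<forall>I\<in>imag_units. \<exists>fx fy :: real \<times> real \<Rightarrow> quat.
        continuous_on (slice_coords I \<Omega>) fx \<and>
        continuous_on (slice_coords I \<Omega>) fy \<and>
        (\<forall>(x, y)\<in>slice_coords I \<Omega>.
           ((\<lambda>s. f (of_real s + of_real y * I)) has_vector_derivative fx (x, y)) (at x) \<and>
           ((\<lambda>t. f (of_real x + of_real t * I)) has_vector_derivative fy (x, y)) (at y) \<and>
           (1 / 2) *\<^sub>R (fx (x, y) + I * fy (x, y)) = 0))"

end

theory Submission
  imports Defs
begin

text \<open>
  As for the classical Bohr theorem, the inequality follows from
  $|a_n| \le 1 - |a_0|^2$ for $n \ge 1$. Multiplying $f$ on the left by $1 + z^n y$ with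
  $y \in L_I$ and comparing mean squares over circles in the slice $L_I$ gives
  $|a_0|^2 + |a_n + y a_0|^2 \le 1 + |y|^2$. The best choice
  $y = |a_0|^2 (1 - |a_0|^2)^{-1} a_n a_0^{-1}$ is available because every quaternion lies in some
  slice.
\<close>

section \<open>Slices and Parseval's identity\<close>

lemma imag_units_iff: "I \<in> imag_units \<longleftrightarrow> I * I = -1"
  by (simp add: imag_units_def power2_eq_square)

lemma norm_imag_unit:
  assumes "I \<in> imag_units"
  shows "norm I = 1"
proof -
  have "norm I * norm I = 1"
    using assms by (metis imag_units_iff norm_minus_cancel norm_mult norm_one)
  then show ?thesis
    by (metis abs_norm_cancel abs_square_eq_1 power2_eq_square)
qed

text \<open>A nonreal quaternion has imaginary part \<open>v\<close> with
  \<open>v * v = - |v|^2\<close>, so normalizing \<open>v\<close> gives the unit \<open>I\<close>. A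
  real quaternion lies in every slice, and any unit serves.\<close>

lemma quat_in_slice:
  obtains I \<alpha> \<beta> where "I \<in> imag_units" "q = of_real \<alpha> + of_real \<beta> * I"
proof (cases "qI q = 0 \<and> qJ q = 0 \<and> qK q = 0")
  case True
  show ?thesis
    by (rule that[of "Quat 0 1 0 0" "qRe q" 0])
      (use True in \<open>auto simp: imag_units_iff quat_eq_iff of_real_def\<close>)
next
  case False
  define v where "v = Quat 0 (qI q) (qJ q) (qK q)"
  have v: "norm v \<noteq> 0"
    using False by (auto simp: v_def quat_eq_iff)
  have vv: "v * v = - of_real ((norm v)\<^sup>2)"
    by (simp add: v_def norm_quat_def quat_eq_iff of_real_def power2_eq_square)
  have "(v /\<^sub>R norm v) * (v /\<^sub>R norm v) = -1"
    using v by (simp add: vv of_real_def power2_eq_square field_simps)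
  moreover have "q = of_real (qRe q) + of_real (norm v) * (v /\<^sub>R norm v)"
    using v by (simp add: of_real_def) (simp add: v_def quat_eq_iff)
  ultimately show ?thesis
    using that imag_units_iff by blast
qed

text \<open>This is the exponential \<open>e^(t I)\<close>, which runs through the unit circle of
  the slice of \<open>I\<close>.\<close>

definition slice_circle :: "quat \<Rightarrow> real \<Rightarrow> quat" where
  "slice_circle I t = of_real (cos t) + of_real (sin t) * I"

lemma slice_circle_power:
  assumes "I \<in> imag_units"
  shows "slice_circle I t ^ k = slice_circle I (of_nat k * t)"
proof (induction k)
  case 0
  then show ?case by (simp add: slice_circle_def)
next
  case (Suc k)
  have I: "I * (I * x) = - x" for x
    using assms by (metis imag_units_iff mult.assoc mult_minus1)
  have "slice_circle I s * slice_circle I u = slice_circle I (s + u)" for s u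
    using assms
    by (simp add: slice_circle_def of_real_def cos_add sin_add algebra_simps imag_units_iff)
  with Suc show ?case
    by (simp add: algebra_simps)
qed

text \<open>Left multiplication by \<open>I\<close> preserves the norm, hence by polarization the
  inner product; with \<open>I * I = -1\<close> this makes it skew-adjoint.\<close>

lemma inner_mult_imag_unit:
  assumes "I \<in> imag_units"
  shows "(I * c) \<bullet> (I * d) = c \<bullet> d" "c \<bullet> (I * d) = - ((I * c) \<bullet> d)"
proof -
  have iso: "(I * c) \<bullet> (I * d) = c \<bullet> d" for c d
  proof -
    have "norm (I * x) = norm x" for x
      using norm_imag_unit[OF assms] by (simp add: norm_mult)
    then show ?thesis
      by (simp add: dot_norm flip: distrib_left)
  qed
  then show "(I * c) \<bullet> (I * d) = c \<bullet> d" .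
  have "I * (I * c) = - c"
    using assms by (metis imag_units_iff mult.assoc mult_minus1)
  then show "c \<bullet> (I * d) = - ((I * c) \<bullet> d)"
    using iso[of "I * c" d] by simp
qed

text \<open>The adjoint of left multiplication by \<open>e^(t I)\<close> is left multiplication by
  \<open>e^(-t I)\<close>, so only \<open>s - t\<close> matters. The sine term remains because
  \<open>c\<close> and \<open>d\<close> are arbitrary quaternions.\<close>

lemma inner_slice_circle:
  assumes "I \<in> imag_units"
  shows "(slice_circle I s * c) \<bullet> (slice_circle I t * d)
    = cos (s - t) * (c \<bullet> d) + sin (s - t) * ((I * c) \<bullet> d)"
proof -
  have "slice_circle I u * x = cos u *\<^sub>R x + sin u *\<^sub>R (I * x)" for u x
    by (simp add: slice_circle_def of_real_def algebra_simps)
  then show ?thesis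
    by (simp add: inner_add_left inner_add_right inner_mult_imag_unit(1)[OF assms]
        inner_mult_imag_unit(2)[OF assms, of c d] cos_diff sin_diff algebra_simps)
qed

lemma norm_slice_circle:
  assumes "I \<in> imag_units"
  shows "norm (slice_circle I t) = 1"
  using inner_slice_circle[OF assms, of t 1 t 1] by (simp add: norm_eq_1 inner_quat_def[of 1])

section \<open>Orthogonality of integer frequencies over a full period\<close>

lemma has_integral_cos_int:
  "((\<lambda>t. cos (of_int m * t)) has_integral (if m = 0 then 2 * pi else 0)) {0..2 * pi}"
proof (cases "m = 0")
  case True
  then show ?thesis
    using has_integral_const_real[of "1::real" 0 "2 * pi"] by simp
next
  case False
  have "((\<lambda>t. cos (of_int m * t)) has_integral
      (sin (of_int m * (2 * pi)) / of_int m - sin (of_int m * 0) / of_int m)) {0..2 * pi}"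
    using False
    by (intro fundamental_theorem_of_calculus)
      (auto intro!: derivative_eq_intros simp flip: has_real_derivative_iff_has_vector_derivative)
  then show ?thesis
    using False sin_int_2pin[of m] by (simp add: mult_ac)
qed

lemma has_integral_sin_int:
  "((\<lambda>t. sin (of_int m * t)) has_integral 0) {0..2 * pi}"
proof (cases "m = 0")
  case False
  have "((\<lambda>t. sin (of_int m * t)) has_integral
      (- cos (of_int m * (2 * pi)) / of_int m - - cos (of_int m * 0) / of_int m)) {0..2 * pi}"
    using False
    by (intro fundamental_theorem_of_calculus)
      (auto intro!: derivative_eq_intros simp flip: has_real_derivative_iff_has_vector_derivative)
  then show ?thesis
    using False cos_int_2pin[of m] by (simp add: mult_ac)
qed simp

text \<open>The square expands into a double sum over \<open>k\<close> and \<open>l\<close> with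
  frequencies \<open>k - l\<close>. All sine terms integrate to zero, and the cosine terms survive
  only on the diagonal.\<close>

lemma slice_parseval:
  assumes "I \<in> imag_units"
  shows "((\<lambda>t. (norm (\<Sum>k<N. slice_circle I t ^ k * c k))\<^sup>2) has_integral
    2 * pi * (\<Sum>k<N. (norm (c k))\<^sup>2)) {0..2 * pi}"
proof -
  have expand: "(norm (\<Sum>k<N. slice_circle I t ^ k * c k))\<^sup>2
    = (\<Sum>k<N. \<Sum>l<N. cos (of_int (int k - int l) * t) * (c k \<bullet> c l)
        + sin (of_int (int k - int l) * t) * ((I * c k) \<bullet> c l))" for t
    by (simp add: power2_norm_eq_inner inner_sum_left inner_sum_right slice_circle_power[OF assms]
        inner_slice_circle[OF assms] left_diff_distrib)
      (rule sum.swap)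
  have "((\<lambda>t. \<Sum>k<N. \<Sum>l<N. cos (of_int (int k - int l) * t) * (c k \<bullet> c l)
        + sin (of_int (int k - int l) * t) * ((I * c k) \<bullet> c l)) has_integral
      (\<Sum>k<N. \<Sum>l<N. (if int k - int l = 0 then 2 * pi else 0) * (c k \<bullet> c l)
        + 0 * ((I * c k) \<bullet> c l))) {0..2 * pi}"
    by (intro has_integral_sum has_integral_add has_integral_mult_left
        has_integral_cos_int has_integral_sin_int) auto
  moreover have "(\<Sum>k<N. \<Sum>l<N. (if int k - int l = 0 then 2 * pi else 0) * (c k \<bullet> c l)
        + 0 * ((I * c k) \<bullet> c l)) = 2 * pi * (\<Sum>k<N. (norm (c k))\<^sup>2)"
    by (simp add: if_distrib[of "\<lambda>x. x * _"] sum_distrib_left power2_norm_eq_inner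
        cong: if_cong)
  ultimately show ?thesis
    unfolding expand by simp
qed

section \<open>The coefficient estimate\<close>

text \<open>Parseval's identity is applied to \<open>1 + z\<^sup>n y\<close> and to its product with the given polynomial;
  since \<open>y\<close> commutes with \<open>I\<close>, that product again has its coefficients on the right.\<close>

lemma polynomial_coeff_bound:
  assumes I: "I \<in> imag_units" and y: "y * I = I * y" and n: "0 < n"
    and c: "\<And>k. N \<le> k \<Longrightarrow> c k = 0"
    and M: "\<And>t. norm (\<Sum>k<N. slice_circle I t ^ k * c k) \<le> M"
  shows "(norm (c 0))\<^sup>2 + (norm (c n + y * c 0))\<^sup>2 \<le> M\<^sup>2 * (1 + (norm y)\<^sup>2)"
proof -
  \<comment> \<open>\<open>d\<close> and \<open>e\<close> are the coefficients of the product and of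
    its first factor. The test \<open>n \<le> k\<close> guards against truncated
    subtraction.\<close>
  define d where "d k = c k + (if n \<le> k then y * c (k - n) else 0)" for k
  define e where "e k = (if k = 0 then 1 else if k = n then y else 0)" for k
  have e_eq: "(\<Sum>k<Suc n. z ^ k * e k) = 1 + z ^ n * y" for z
  proof -
    have "(\<Sum>k<Suc n. z ^ k * e k) = (\<Sum>k\<in>{0, n}. z ^ k * e k)"
      by (rule sum.mono_neutral_right) (auto simp: e_def)
    then show ?thesis
      using n by (simp add: e_def)
  qed
  have e_norm: "(\<Sum>k<Suc n. (norm (e k))\<^sup>2) = 1 + (norm y)\<^sup>2"
  proof -
    have "(\<Sum>k<Suc n. (norm (e k))\<^sup>2) = (\<Sum>k\<in>{0, n}. (norm (e k))\<^sup>2)"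
      by (rule sum.mono_neutral_right) (auto simp: e_def)
    then show ?thesis
      using n by (simp add: e_def)
  qed
  have d_eq: "(\<Sum>k<N + n. z ^ k * d k) = (1 + z ^ n * y) * (\<Sum>k<N. z ^ k * c k)"
    if "y * z = z * y" for z
  proof -
    have comm: "y * z ^ k = z ^ k * y" for k
      using that by (metis power_commuting_commutes)
    have 1: "(\<Sum>k<N + n. z ^ k * c k) = (\<Sum>k<N. z ^ k * c k)"
      by (rule sum.mono_neutral_right) (auto simp: c)
    have "(\<Sum>k<N + n. z ^ k * (if n \<le> k then y * c (k - n) else 0))
      = (\<Sum>k\<in>{n..<N + n}. z ^ k * (y * c (k - n)))"
      by (rule sum.mono_neutral_cong_right) auto
    also have "\<dots> = (\<Sum>k<N. z ^ (k + n) * (y * c k))"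
      using sum.shift_bounds_nat_ivl[of "\<lambda>k. z ^ k * (y * c (k - n))" 0 n N]
      by (simp add: atLeast0LessThan)
    also have "\<dots> = z ^ n * y * (\<Sum>k<N. z ^ k * c k)"
      unfolding sum_distrib_left
    proof (rule sum.cong)
      fix k
      have "z ^ (k + n) * (y * c k) = z ^ n * (z ^ k * y) * c k"
        by (metis add.commute mult.assoc power_add)
      then show "z ^ (k + n) * (y * c k) = z ^ n * y * (z ^ k * c k)"
        by (metis comm mult.assoc)
    qed simp
    finally show ?thesis
      unfolding d_def by (simp add: distrib_left sum.distrib 1 distrib_right)
  qed
  have "y * slice_circle I t = slice_circle I t * y" for t
    using y by (simp add: slice_circle_def of_real_def algebra_simps)
  note comm = this
  have "(norm (\<Sum>k<N + n. slice_circle I t ^ k * d k))\<^sup>2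
      \<le> M\<^sup>2 * (norm (\<Sum>k<Suc n. slice_circle I t ^ k * e k))\<^sup>2" for t
    using M[of t] unfolding d_eq[OF comm] e_eq
    by (simp add: norm_mult power_mult_distrib mult.commute[of "M\<^sup>2"] mult_left_mono power_mono)
  \<comment> \<open>Integrating the pointwise bound turns both sides into sums of squared
    coefficients.\<close>
  then have "2 * pi * (\<Sum>k<N + n. (norm (d k))\<^sup>2) \<le> M\<^sup>2 * (2 * pi * (\<Sum>k<Suc n. (norm (e k))\<^sup>2))"
    by (intro has_integral_le[OF slice_parseval[OF I] has_integral_mult_right[OF slice_parseval[OF I]]])
  then have "(2 * pi) * (\<Sum>k<N + n. (norm (d k))\<^sup>2) \<le> (2 * pi) * (M\<^sup>2 * (1 + (norm y)\<^sup>2))"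
    unfolding e_norm by (simp only: mult_ac)
  then have *: "(\<Sum>k<N + n. (norm (d k))\<^sup>2) \<le> M\<^sup>2 * (1 + (norm y)\<^sup>2)"
    by (rule mult_left_le_imp_le) simp
  have "(norm (c 0))\<^sup>2 + (norm (c n + y * c 0))\<^sup>2 = (\<Sum>k\<in>{0, n}. (norm (d k))\<^sup>2)"
    using n by (simp add: d_def)
  also have "\<dots> \<le> (\<Sum>k<N + n. (norm (d k))\<^sup>2)"
  proof (cases "N = 0")
    \<comment> \<open>For \<open>N = 0\<close> the index \<open>n\<close> falls outside the range of
      summation, but then every coefficient vanishes.\<close>
    case True
    then show ?thesis
      using n by (simp add: d_def c)
  qed (auto intro!: sum_mono2)
  finally show ?thesis
    using * by linarith
qed

text \<open>On a circle of radius \<open>r < 1\<close> the partial sums are bounded by 1 plus a tail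
  that tends to 0, so the polynomial estimate passes to the limit in \<open>N\<close>. Afterwards
  \<open>r\<close> tends to 1.\<close>

lemma power_series_coeff_bound:
  fixes a :: "nat \<Rightarrow> quat"
  assumes f: "\<And>p. norm p < 1 \<Longrightarrow> (\<lambda>n. p ^ n * a n) sums f p"
    and f1: "\<And>p. norm p < 1 \<Longrightarrow> norm (f p) \<le> 1"
    and I: "I \<in> imag_units" and y: "y * I = I * y" and n: "0 < n"
  shows "(norm (a 0))\<^sup>2 + (norm (a n + y * a 0))\<^sup>2 \<le> 1 + (norm y)\<^sup>2"
proof -
  have bound: "(norm (a 0))\<^sup>2 + (norm (of_real (r ^ n) * a n + y * a 0))\<^sup>2 \<le> 1 + (norm y)\<^sup>2"
    if r: "0 < r" "r < 1" for r :: real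
  proof -
    define b where "b k = of_real (r ^ k) * a k" for k
    define R where "R N = (\<Sum>k. norm (b (k + N)))" for N
    \<comment> \<open>Convergence at the larger radius \<open>s\<close> yields absolute convergence
      at \<open>r\<close>.\<close>
    obtain s where s: "r < s" "s < 1"
      using dense r by blast
    have "summable (\<lambda>k. a k * of_real s ^ k)"
      using f[of "of_real s"] r s
      by (simp add: sums_iff of_real_def mult.commute flip: of_real_power)
    then have "summable (\<lambda>k. norm (a k * of_real r ^ k))"
      by (rule powser_insidea) (use r s in auto)
    then have b: "summable (\<lambda>k. norm (b k))"
      by (simp add: b_def norm_mult norm_power mult.commute)
    \<comment> \<open>The coefficients are cut off at \<open>N\<close> because the polynomial
      estimate asks for them to vanish from there on.\<close>
    have M: "norm (\<Sum>k<N. slice_circle I t ^ k * (if k < N then b k else 0)) \<le> 1 + R N" for N t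
    proof -
      define z where "z = of_real r * slice_circle I t"
      have z: "norm z < 1"
        using r by (simp add: z_def norm_mult norm_slice_circle[OF I])
      have zk: "z ^ k * a k = slice_circle I t ^ k * b k" for k
      proof -
        have "z ^ k = r ^ k *\<^sub>R slice_circle I t ^ k"
          by (simp add: z_def of_real_def scaleR_power)
        then show ?thesis
          by (simp add: b_def of_real_def)
      qed
      have nk: "norm (z ^ k * a k) = norm (b k)" for k
        unfolding zk by (simp add: norm_mult norm_power norm_slice_circle[OF I])
      have summ: "summable (\<lambda>k. norm (z ^ (k + N) * a (k + N)))"
        unfolding nk using b by (rule summable_ignore_initial_segment)
      have "f z = (\<Sum>k. z ^ (k + N) * a (k + N)) + (\<Sum>k<N. z ^ k * a k)"
        using f[OF z] suminf_split_initial_segment[of "\<lambda>k. z ^ k * a k" N] by (simp add: sums_iff)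
      then have "(\<Sum>k<N. z ^ k * a k) = f z - (\<Sum>k. z ^ (k + N) * a (k + N))"
        by (simp add: algebra_simps)
      moreover have "norm (\<Sum>k. z ^ (k + N) * a (k + N)) \<le> R N"
        using summable_norm[OF summ] by (simp add: nk R_def)
      ultimately have "norm (\<Sum>k<N. z ^ k * a k) \<le> 1 + R N"
        using f1[OF z] norm_triangle_ineq4[of "f z" "\<Sum>k. z ^ (k + N) * a (k + N)"] by simp
      then show ?thesis
        by (simp add: zk)
    qed
    have R: "R \<longlonglongrightarrow> 0"
      unfolding R_def using suminf_exist_split2[OF b] by simp
    have "(\<lambda>N. (1 + R N)\<^sup>2 * (1 + (norm y)\<^sup>2)) \<longlonglongrightarrow> (1 + 0)\<^sup>2 * (1 + (norm y)\<^sup>2)"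
      by (intro tendsto_intros R)
    moreover have "(norm (b 0))\<^sup>2 + (norm (b n + y * b 0))\<^sup>2 \<le> (1 + R N)\<^sup>2 * (1 + (norm y)\<^sup>2)"
      \<comment> \<open>This keeps \<open>b n\<close> among the coefficients that survive the
        cutoff.\<close>
      if "N > n" for N
      using polynomial_coeff_bound[OF I y n _ M, of N] that by simp
    ultimately have "(norm (b 0))\<^sup>2 + (norm (b n + y * b 0))\<^sup>2 \<le> (1 + 0)\<^sup>2 * (1 + (norm y)\<^sup>2)"
      by (intro LIMSEQ_le_const[where X = "\<lambda>N. (1 + R N)\<^sup>2 * (1 + (norm y)\<^sup>2)"])
        (auto intro!: exI[of _ "Suc n"])
    then show ?thesis
      by (simp add: b_def)
  qed
  have "((\<lambda>r. (norm (a 0))\<^sup>2 + (norm (of_real (r ^ n) * a n + y * a 0))\<^sup>2)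
      \<longlongrightarrow> (norm (a 0))\<^sup>2 + (norm (of_real (1 ^ n) * a n + y * a 0))\<^sup>2) (at_left (1::real))"
    by (intro tendsto_intros)
  moreover have "eventually (\<lambda>r::real. 0 < r \<and> r < 1) (at_left 1)"
    using eventually_at_left_real[of 0 1] by simp
  then have "eventually (\<lambda>r. (norm (a 0))\<^sup>2 + (norm (of_real (r ^ n) * a n + y * a 0))\<^sup>2
      \<le> 1 + (norm y)\<^sup>2) (at_left (1::real))"
    by eventually_elim (use bound in blast)
  ultimately show ?thesis
    by (intro tendsto_upperbound[where F = "at_left (1::real)"]) auto
qed

text \<open>With \<open>y = t *\<^sub>R h\<close> the vector \<open>a n + y * a 0\<close> is a
  multiple of \<open>a n\<close>, and the previous estimate becomes a scalar inequality between
  \<open>s\<close> and \<open>r\<close>.\<close>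

lemma coeff_le_one_minus_square:
  fixes a :: "nat \<Rightarrow> quat"
  assumes f: "\<And>p. norm p < 1 \<Longrightarrow> (\<lambda>n. p ^ n * a n) sums f p"
    and f1: "\<And>p. norm p < 1 \<Longrightarrow> norm (f p) \<le> 1"
    and a0: "norm (a 0) < 1" and n: "0 < n"
  shows "norm (a n) \<le> 1 - (norm (a 0))\<^sup>2"
proof -
  define r s where "r = norm (a 0)" and "s = norm (a n)"
  define t where "t = r\<^sup>2 / (1 - r\<^sup>2)"
  define h where "h = a n * inverse (a 0)"
  have r: "r\<^sup>2 < 1"
    using a0 by (simp add: r_def abs_square_less_1)
  obtain I \<alpha> \<beta> where I: "I \<in> imag_units" and h: "h = of_real \<alpha> + of_real \<beta> * I"
    by (rule quat_in_slice)
  \<comment> \<open>The unit \<open>I\<close> was chosen so that \<open>h\<close> lies in its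
    slice.\<close>
  have "(t *\<^sub>R h) * I = I * (t *\<^sub>R h)"
    unfolding h by (simp add: of_real_def algebra_simps)
  note b = power_series_coeff_bound[OF f f1 I this n, folded r_def]
  have t1: "1 + t = 1 / (1 - r\<^sup>2)"
    using r by (simp add: t_def field_simps)
  have "a n + t *\<^sub>R h * a 0 = (1 + t) *\<^sub>R a n"
  proof (cases "a 0 = 0")
    \<comment> \<open>Here \<open>t = 0\<close>, so both sides equal \<open>a n\<close>.\<close>
    case True
    then show ?thesis by (simp add: t_def r_def)
  next
    case False
    then show ?thesis
      by (simp add: h_def mult.assoc scaleR_left_distrib)
  qed
  then have 1: "(norm (a n + t *\<^sub>R h * a 0))\<^sup>2 = s\<^sup>2 / (1 - r\<^sup>2)\<^sup>2"
    by (simp add: t1 s_def power_mult_distrib power_divide)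
  have 2: "(norm (t *\<^sub>R h))\<^sup>2 = s\<^sup>2 * r\<^sup>2 / (1 - r\<^sup>2)\<^sup>2"
    by (simp add: t_def h_def norm_mult norm_inverse power_mult_distrib power_divide
        flip: r_def s_def)
      (simp add: divide_simps power2_eq_square power4_eq_xxxx)
  define u where "u = 1 - r\<^sup>2"
  have u: "0 < u" and r2: "r\<^sup>2 = 1 - u"
    using r by (auto simp: u_def)
  \<comment> \<open>The estimate reads
    \<open>(1 - u) + s^2 / u^2 \<le> 1 + s^2 (1 - u) / u^2\<close>; this splitting cancels the terms
    \<open>s^2 / u^2\<close>.\<close>
  have "s\<^sup>2 * (1 - u) / u\<^sup>2 = s\<^sup>2 / u\<^sup>2 - s\<^sup>2 / u"
    using u by (simp add: field_simps power2_eq_square)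
  then have "s\<^sup>2 / u \<le> u"
    using b unfolding 1 2 unfolding r2 by simp
  then have "s\<^sup>2 \<le> u\<^sup>2"
    using u by (simp add: pos_divide_le_eq power2_eq_square)
  then show ?thesis
    using u by (simp add: power2_le_iff_abs_le flip: r_def s_def u_def)
qed

text \<open>Since the powers of 1/3 from the first on add up to 1/2, the series is at most
  \<open>r + (1 - r^2) / 2 = 1 - (1 - r)^2 / 2\<close>, which is below 1 because
  \<open>r < 1\<close>.\<close>

lemma bohr_inequality:
  fixes a :: "nat \<Rightarrow> quat"
  assumes f: "\<And>p. norm p < 1 \<Longrightarrow> (\<lambda>n. p ^ n * a n) sums f p"
    and f1: "\<And>p. norm p < 1 \<Longrightarrow> norm (f p) < 1"
    and q: "norm q \<le> 1 / 3"
  shows "summable (\<lambda>n. norm (q ^ n * a n))" "(\<Sum>n. norm (q ^ n * a n)) < 1"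
proof -
  define r where "r = norm (a 0)"
  have "(\<lambda>n. 0 ^ n * a n) = (\<lambda>n. if n = 0 then a n else 0)"
    by (auto simp: power_0_left)
  then have "(\<lambda>n. 0 ^ n * a n) sums a 0"
    using sums_single[of 0 a] by simp
  then have "f 0 = a 0"
    using f[of 0] sums_unique2 by fastforce
  then have r: "r < 1"
    using f1[of 0] by (simp add: r_def)
  \<comment> \<open>A full geometric series whose term at 0 is corrected to
    \<open>r\<close>.\<close>
  define b where "b = (\<lambda>n::nat. (if n = 0 then r - (1 - r\<^sup>2) else 0) + (1 - r\<^sup>2) * (1 / 3) ^ n)"
  have "b sums ((r - (1 - r\<^sup>2)) + (1 - r\<^sup>2) * (1 / (1 - 1 / 3)))"
    unfolding b_def by (intro sums_add sums_single sums_mult geometric_sums) simp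
  then have b: "b sums (1 - (1 - r)\<^sup>2 / 2)"
    by (simp add: power2_eq_square field_simps)
  have le: "norm (q ^ n * a n) \<le> b n" for n
  proof (cases "n = 0")
    case True
    then show ?thesis by (simp add: b_def r_def)
  next
    case False
    have "norm (q ^ n * a n) = norm q ^ n * norm (a n)"
      by (simp add: norm_mult norm_power)
    also have "\<dots> \<le> (1 / 3) ^ n * (1 - r\<^sup>2)"
      unfolding r_def
    proof (intro mult_mono power_mono q)
      show "norm (a n) \<le> 1 - (norm (a 0))\<^sup>2"
        by (rule coeff_le_one_minus_square[OF f _ r[unfolded r_def]])
          (use f1 False in \<open>auto intro: less_imp_le\<close>)
    qed auto
    finally show ?thesis
      using False by (simp add: b_def mult.commute)
  qed
  show summ: "summable (\<lambda>n. norm (q ^ n * a n))"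
    by (rule summable_comparison_test'[OF sums_summable[OF b]]) (use le in auto)
  have "(\<Sum>n. norm (q ^ n * a n)) \<le> 1 - (1 - r)\<^sup>2 / 2"
    using suminf_le[OF le summ sums_summable[OF b]] b by (simp add: sums_iff)
  moreover have "0 < (1 - r)\<^sup>2"
    using r by simp
  ultimately show "(\<Sum>n. norm (q ^ n * a n)) < 1"
    by linarith
qed

section \<open>Sharpness\<close>

text \<open>Telescoping survives noncommutativity because \<open>q\<close> commutes with its own
  powers.\<close>

lemma quat_geometric_sums:
  fixes q :: quat
  assumes "norm q < 1"
  shows "(\<lambda>n. q ^ n) sums inverse (1 - q)"
proof -
  have ne: "1 - q \<noteq> 0"
    using assms by auto
  have "(\<Sum>i<n. q ^ i) * (1 - q) = 1 - q ^ n" for n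
  proof (induction n)
    case (Suc n)
    have "(\<Sum>i<Suc n. q ^ i) * (1 - q) = (\<Sum>i<n. q ^ i) * (1 - q) + (q ^ n - q ^ n * q)"
      by (simp add: distrib_right right_diff_distrib)
    then show ?case
      unfolding Suc by (simp add: power_commutes)
  qed simp
  then have eq: "(\<Sum>i<n. q ^ i) = (1 - q ^ n) * inverse (1 - q)" for n
    using ne by (metis mult.assoc mult.right_neutral right_inverse)
  have "(\<lambda>n. (1 - q ^ n) * inverse (1 - q)) \<longlonglongrightarrow> (1 - 0) * inverse (1 - q)"
    by (intro tendsto_intros LIMSEQ_power_zero assms)
  then show ?thesis
    by (simp add: sums_def eq)
qed

text \<open>The partial fraction form of $(a - q)(1 - aq)^{-1}$, in which \<open>q\<close> occurs only once.\<close>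

definition moebius :: "real \<Rightarrow> quat \<Rightarrow> quat" where
  "moebius a q = (1 / a) *\<^sub>R 1 - (1 / a - a) *\<^sub>R inverse (1 - a *\<^sub>R q)"

text \<open>The value is \<open>a\<close> at 0 and \<open>- (1 - a^2) a^(n - 1)\<close> for positive
  \<open>n\<close>.\<close>

definition moebius_coeff :: "real \<Rightarrow> nat \<Rightarrow> real" where
  "moebius_coeff a n = (if n = 0 then 1 / a else 0) - (1 / a - a) * a ^ n"

section \<open>Bounds and power series of the Moebius map\<close>

lemma moebius_denom_nonzero:
  fixes q :: quat
  assumes "0 < a" "a < 1" "norm q \<le> 1"
  shows "1 - a *\<^sub>R q \<noteq> 0"
proof
  assume "1 - a *\<^sub>R q = 0"
  then have "norm (a *\<^sub>R q) = norm (1 :: quat)"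
    by simp
  moreover have "a * norm q \<le> a * 1"
    using assms by (intro mult_left_mono) auto
  ultimately show False
    using assms by simp
qed

text \<open>Multiplying by the denominator \<open>w\<close> gives \<open>a - q\<close>, and
  \<open>|w|^2 - |a - q|^2 = (1 - a^2) (1 - |q|^2)\<close> is nonnegative.\<close>

lemma norm_moebius_le:
  assumes a: "0 < a" "a < 1" and q: "norm q \<le> 1"
  shows "norm (moebius a q) \<le> 1"
proof -
  define w where "w = 1 - a *\<^sub>R q"
  have w: "w \<noteq> 0"
    unfolding w_def by (rule moebius_denom_nonzero[OF assms])
  have "moebius a q * w = (1 / a) *\<^sub>R w - (1 / a - a) *\<^sub>R 1"
    using w by (simp add: moebius_def algebra_simps flip: w_def)
  also have "\<dots> = a *\<^sub>R 1 - q"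
    using a by (simp add: w_def algebra_simps)
  finally have eq: "norm (moebius a q) * norm w = norm (a *\<^sub>R 1 - q)"
    by (metis norm_mult)
  have "(norm w)\<^sup>2 - (norm (a *\<^sub>R 1 - q))\<^sup>2 = (1 - a\<^sup>2) * (1 - (norm q)\<^sup>2)"
    unfolding w_def power2_norm_eq_inner inner_quat_def
    by (simp add: power2_eq_square algebra_simps)
  also have "\<dots> \<ge> 0"
    using a q by (intro mult_nonneg_nonneg) (auto simp: abs_square_le_1)
  finally have "norm (a *\<^sub>R 1 - q) \<le> norm w"
    by (simp add: abs_le_square_iff[symmetric])
  then show ?thesis
    using w mult_le_cancel_right_pos[of "norm w" "norm (moebius a q)" 1] by (simp add: eq)
qed

lemma moebius_sums:
  assumes a: "0 < a" "a < 1" and q: "norm q < 1"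
  shows "(\<lambda>n. q ^ n * of_real (moebius_coeff a n)) sums moebius a q"
proof -
  have "a * norm q < 1 * 1"
    using assms by (intro mult_strict_mono') auto
  then have "(\<lambda>n. (a *\<^sub>R q) ^ n) sums inverse (1 - a *\<^sub>R q)"
    using a by (intro quat_geometric_sums) simp
  then have "(\<lambda>n. (if n = 0 then (1 / a) *\<^sub>R 1 else 0) - (1 / a - a) *\<^sub>R (a *\<^sub>R q) ^ n) sums moebius a q"
    unfolding moebius_def by (intro sums_diff sums_single sums_scaleR_right)
  moreover have "(if n = 0 then (1 / a) *\<^sub>R 1 else 0) - (1 / a - a) *\<^sub>R (a *\<^sub>R q) ^ n
      = q ^ n * of_real (moebius_coeff a n)" for n
    by (auto simp: moebius_coeff_def of_real_def scaleR_power scaleR_left_diff_distrib)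
  ultimately show ?thesis
    by simp
qed

lemma moebius_abs_sums:
  assumes a: "0 < a" "a < 1" and r: "0 \<le> r" "r < 1"
  shows "(\<lambda>n. r ^ n * \<bar>moebius_coeff a n\<bar>) sums (a - (1 / a - a) + (1 / a - a) / (1 - a * r))"
proof -
  have "a * r < 1 * 1"
    using assms by (intro mult_strict_mono') auto
  then have "(\<lambda>n. (a * r) ^ n) sums (1 / (1 - a * r))"
    using a r by (intro geometric_sums) simp
  \<comment> \<open>All coefficients of positive index are negative, so absolute values flip the
    geometric part; the term at 0 is corrected to \<open>a\<close>.\<close>
  then have "(\<lambda>n. (if n = 0 then a - (1 / a - a) else 0) + (1 / a - a) * (a * r) ^ n)
      sums (a - (1 / a - a) + (1 / a - a) * (1 / (1 - a * r)))"
    by (intro sums_add sums_single sums_mult)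
  moreover have "1 / a - a \<ge> 0"
    using a by (simp add: field_simps mult_le_one)
  then have "(if n = 0 then a - (1 / a - a) else 0) + (1 / a - a) * (a * r) ^ n
      = r ^ n * \<bar>moebius_coeff a n\<bar>" for n
    using a by (auto simp: moebius_coeff_def abs_mult power_mult_distrib)
  ultimately show ?thesis
    by simp
qed

section \<open>Continuity and slice regularity of the Moebius map\<close>

lemma moebius_continuous:
  assumes "0 < a" "a < 1"
  shows "continuous_on (cball 0 1) (moebius a)"
  unfolding moebius_def
  by (intro continuous_intros) (use moebius_denom_nonzero[OF assms] in auto)

text \<open>The derivative of an inverse keeps \<open>h\<close> between two inverse factors, as they
  need not commute. It is applied with \<open>h = 1\<close> and \<open>h = I\<close> for the two
  partial derivatives.\<close>

lemma moebius_has_vector_derivative: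
  assumes g: "(g has_vector_derivative h) (at s)" and ne: "1 - a *\<^sub>R g s \<noteq> 0" and a: "a \<noteq> 0"
  shows "((\<lambda>s. moebius a (g s)) has_vector_derivative
    (a\<^sup>2 - 1) *\<^sub>R (inverse (1 - a *\<^sub>R g s) * h * inverse (1 - a *\<^sub>R g s))) (at s)"
proof -
  have "((\<lambda>s. 1 - a *\<^sub>R g s) has_vector_derivative 0 - a *\<^sub>R h) (at s)"
    by (intro derivative_intros g bounded_linear.has_vector_derivative[OF bounded_linear_scaleR_right])
  then have "((\<lambda>s. inverse (1 - a *\<^sub>R g s)) has_vector_derivative
      - (inverse (1 - a *\<^sub>R g s) * (0 - a *\<^sub>R h) * inverse (1 - a *\<^sub>R g s))) (at s)"
    unfolding has_vector_derivative_def
    by (rule has_derivative_eq_rhs[OF has_derivative_compose[where f = "\<lambda>s. 1 - a *\<^sub>R g s" and g = inverse,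
          OF _ has_derivative_inverse'[OF ne, of UNIV]]])
      (simp add: fun_eq_iff)
  then have "((\<lambda>s. moebius a (g s)) has_vector_derivative
      0 - (1 / a - a) *\<^sub>R - (inverse (1 - a *\<^sub>R g s) * (0 - a *\<^sub>R h) * inverse (1 - a *\<^sub>R g s))) (at s)"
    unfolding moebius_def
    by (intro derivative_intros bounded_linear.has_vector_derivative[OF bounded_linear_scaleR_right])
  moreover have "(1 / a - a) * a = 1 - a\<^sup>2"
    using a by (simp add: field_simps power2_eq_square)
  ultimately show ?thesis
    using a by (simp add: algebra_simps power2_eq_square)
qed

text \<open>On the slice of \<open>I\<close> the inverse denominator \<open>w\<close> commutes with
  \<open>I\<close>, so \<open>I * (w * I * w) = - w * w\<close> cancels the derivative in
  \<open>x\<close>.\<close>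

lemma moebius_slice_regular:
  assumes a: "0 < a" "a < 1"
  shows "slice_regular_on (\<lambda>q. c *\<^sub>R moebius a q) (ball 0 1)"
  unfolding slice_regular_on_def
proof (intro conjI ballI)
  show "connected (ball (0::quat) 1)"
    by (simp add: convex_connected)
  fix I assume I: "I \<in> imag_units"
  define w :: "real \<times> real \<Rightarrow> quat"
    where "w = (\<lambda>(x, y). inverse (1 - a *\<^sub>R (of_real x + of_real y * I)))"
  define D where "D h = (\<lambda>p. c *\<^sub>R (a\<^sup>2 - 1) *\<^sub>R (w p * h * w p))" for h
  have ne: "1 - a *\<^sub>R (of_real x + of_real y * I) \<noteq> 0" if "(x, y) \<in> slice_coords I (ball 0 1)" for x y
    using that by (intro moebius_denom_nonzero a) (auto simp: slice_coords_def)
  have "continuous_on (slice_coords I (ball 0 1)) w"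
    unfolding w_def case_prod_beta by (intro continuous_intros) (use ne in auto)
  then have D_cont: "continuous_on (slice_coords I (ball 0 1)) (D h)" for h
    unfolding D_def by (intro continuous_intros)
  have dx: "((\<lambda>s. c *\<^sub>R moebius a (of_real s + of_real y * I)) has_vector_derivative D 1 (x, y)) (at x)"
    and dy: "((\<lambda>t. c *\<^sub>R moebius a (of_real x + of_real t * I)) has_vector_derivative D I (x, y)) (at y)"
    if "(x, y) \<in> slice_coords I (ball 0 1)" for x y
  proof -
    have "((\<lambda>s. of_real s + of_real y * I) has_vector_derivative 1) (at x)"
      "((\<lambda>t. of_real x + of_real t * I) has_vector_derivative I) (at y)"
      unfolding of_real_def by (auto intro!: derivative_eq_intros)
    note 1 = moebius_has_vector_derivative[OF this(1) ne[OF that]]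
      and 2 = moebius_has_vector_derivative[OF this(2) ne[OF that]]
    show "((\<lambda>s. c *\<^sub>R moebius a (of_real s + of_real y * I)) has_vector_derivative D 1 (x, y)) (at x)"
      unfolding D_def w_def prod.case
      by (intro bounded_linear.has_vector_derivative[OF bounded_linear_scaleR_right] 1) (use a in simp)
    show "((\<lambda>t. c *\<^sub>R moebius a (of_real x + of_real t * I)) has_vector_derivative D I (x, y)) (at y)"
      unfolding D_def w_def prod.case
      by (intro bounded_linear.has_vector_derivative[OF bounded_linear_scaleR_right] 2) (use a in simp)
  qed
  have "D 1 (x, y) + I * D I (x, y) = 0" if "(x, y) \<in> slice_coords I (ball 0 1)" for x y
  proof -
    have "I * (1 - a *\<^sub>R (of_real x + of_real y * I)) = (1 - a *\<^sub>R (of_real x + of_real y * I)) * I"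
      by (simp add: of_real_def algebra_simps)
    then have "I * w (x, y) = w (x, y) * I"
      unfolding w_def prod.case
      by (metis mult_commute_imp_mult_inverse_commute)
    then have "I * (w (x, y) * I * w (x, y)) = w (x, y) * (I * I) * w (x, y)"
      by (metis mult.assoc)
    then show ?thesis
      using I by (simp add: D_def imag_units_iff)
  qed
  then show "\<exists>fx fy. continuous_on (slice_coords I (ball 0 1)) fx \<and>
      continuous_on (slice_coords I (ball 0 1)) fy \<and>
      (\<forall>(x, y)\<in>slice_coords I (ball 0 1).
        ((\<lambda>s. c *\<^sub>R moebius a (of_real s + of_real y * I)) has_vector_derivative fx (x, y)) (at x) \<and>
        ((\<lambda>t. c *\<^sub>R moebius a (of_real x + of_real t * I)) has_vector_derivative fy (x, y)) (at y) \<and>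
        (1 / 2) *\<^sub>R (fx (x, y) + I * fy (x, y)) = 0)"
    using D_cont dx dy by (intro exI[of _ "D 1"] exI[of _ "D I"]) auto
qed auto

text \<open>The witness is \<open>c (a - q) (1 - a q)\<^sup>-\<^sup>1\<close>: at \<open>q = r\<close> its absolute series is
  \<open>c (a + (1 - a\<^sup>2) r / (1 - a r))\<close>, which for \<open>c = 1\<close> exceeds 1 as soon as \<open>(1 + 2 a) r > 1\<close>.\<close>

lemma bohr_radius_sharp:
  assumes "\<rho> > 1 / 3"
  shows "\<exists>f a. slice_regular_on f (ball 0 1) \<and>
      (\<forall>p\<in>ball 0 1. (\<lambda>n. p ^ n * a n) sums f p) \<and>
      continuous_on (cball 0 1) f \<and>
      (\<forall>p. norm p \<le> 1 \<longrightarrow> norm (f p) < 1) \<and>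
      (\<exists>q. norm q \<le> \<rho> \<and>
        \<not> (summable (\<lambda>n. norm (q ^ n * a n)) \<and> (\<Sum>n. norm (q ^ n * a n)) < 1))"
proof -
  \<comment> \<open>The cap 1/2 keeps \<open>r\<close> inside the unit ball, where the series
    converges.\<close>
  define r where "r = min \<rho> (1 / 2)"
  have r: "1 / 3 < r" "r \<le> 1 / 2" "r \<le> \<rho>"
    using assms by (auto simp: r_def)
  \<comment> \<open>The condition \<open>(1 + 2 * a) * r > 1\<close> means
    \<open>a > (1 / r - 1) / 2\<close>; a suitable \<open>a < 1\<close> exists because
    \<open>r > 1 / 3\<close>.\<close>
  have "(1 / r - 1) / 2 < 1"
    using r by (simp add: field_simps)
  then obtain a where a': "(1 / r - 1) / 2 < a" and a1: "a < 1"
    using dense by blast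
  have "(1 / r - 1) / 2 > 0"
    using r by (simp add: field_simps)
  with a' a1 have a: "0 < a" "a < 1"
    by auto
  have ar: "(1 + 2 * a) * r > 1"
    using a' r by (simp add: field_simps)
  define S where "S = a - (1 / a - a) + (1 / a - a) / (1 - a * r)"
  have "a * r < 1 * 1"
    using a r by (intro mult_strict_mono') auto
  then have arlt: "1 - a * r > 0"
    by simp
  have "S - 1 = (1 - a) * ((1 + 2 * a) * r - 1) / (1 - a * r)"
    using a arlt by (simp add: S_def divide_simps) (simp add: algebra_simps)
  also have "\<dots> > 0"
    using a ar arlt by simp
  finally have S: "S > 1" by simp
  then have "1 / S < 1" by simp
  \<comment> \<open>Scaling by \<open>c < 1\<close> makes the bound strict on the closed ball, while
    \<open>c > 1 / S\<close> keeps the absolute sum above 1.\<close>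
  then obtain c where c: "1 / S < c" "c < 1"
    using dense by blast
  have c0: "0 < c"
    using c S by (smt (verit) divide_pos_pos)
  have cS: "c * S > 1"
    using c S by (simp add: field_simps)
  have "norm (c *\<^sub>R moebius a p) < 1" if "norm p \<le> 1" for p
  proof -
    have "norm (c *\<^sub>R moebius a p) = c * norm (moebius a p)"
      using c0 by simp
    also have "\<dots> \<le> c * 1"
      using c0 by (intro mult_left_mono norm_moebius_le a that) auto
    finally show ?thesis
      using c by linarith
  qed
  moreover have "(\<lambda>n. p ^ n * c *\<^sub>R of_real (moebius_coeff a n)) sums (c *\<^sub>R moebius a p)"
    if "norm p < 1" for p
    using sums_scaleR_right[OF moebius_sums[OF a that], of c] by simp
  moreover have "continuous_on (cball 0 1) (\<lambda>q. c *\<^sub>R moebius a q)"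
    by (intro continuous_intros moebius_continuous a)
  moreover have "(\<lambda>n. c * (r ^ n * \<bar>moebius_coeff a n\<bar>)) sums (c * S)"
    unfolding S_def using a r by (intro sums_mult moebius_abs_sums) auto
  then have "(\<lambda>n. norm (of_real r ^ n * c *\<^sub>R of_real (moebius_coeff a n) :: quat)) sums (c * S)"
    using c0 r by (simp add: norm_mult norm_power mult_ac)
  \<comment> \<open>The series converges at this point, so it is the bound on the sum that
    fails.\<close>
  then have "\<not> (\<Sum>n. norm (of_real r ^ n * c *\<^sub>R of_real (moebius_coeff a n) :: quat)) < 1"
    using cS by (simp add: sums_iff)
  moreover have "norm (of_real r :: quat) \<le> \<rho>"
    using r by simp
  ultimately show ?thesis
    using moebius_slice_regular[OF a, of c]
    by (intro exI[of _ "\<lambda>q. c *\<^sub>R moebius a q"]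
        exI[of _ "\<lambda>n. c *\<^sub>R of_real (moebius_coeff a n)"] conjI exI[of _ "of_real r"]) auto
qed

theorem theorem4p1:
  shows "(\<forall>(f :: quat \<Rightarrow> quat) (a :: nat \<Rightarrow> quat).
            slice_regular_on f (ball 0 1) \<and>
            (\<forall>p\<in>ball 0 1. (\<lambda>n. p ^ n * a n) sums f p) \<and>
            continuous_on (cball 0 1) f \<and>
            (\<forall>p. norm p \<le> 1 \<longrightarrow> norm (f p) < 1) \<longrightarrow>
            (\<forall>q. norm q \<le> 1 / 3 \<longrightarrow>
               summable (\<lambda>n. norm (q ^ n * a n)) \<and> (\<Sum>n. norm (q ^ n * a n)) < 1))
       \<and> (\<forall>\<rho>::real. \<rho> > 1 / 3 \<longrightarrow>
            (\<exists>(f :: quat \<Rightarrow> quat) (a :: nat \<Rightarrow> quat).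
               slice_regular_on f (ball 0 1) \<and>
               (\<forall>p\<in>ball 0 1. (\<lambda>n. p ^ n * a n) sums f p) \<and>
               continuous_on (cball 0 1) f \<and>
               (\<forall>p. norm p \<le> 1 \<longrightarrow> norm (f p) < 1) \<and>
               (\<exists>q. norm q \<le> \<rho> \<and>
                  \<not> (summable (\<lambda>n. norm (q ^ n * a n)) \<and> (\<Sum>n. norm (q ^ n * a n)) < 1))))"
proof (rule conjI; intro allI impI)
  fix f :: "quat \<Rightarrow> quat" and a :: "nat \<Rightarrow> quat" and q :: quat
  assume f: "slice_regular_on f (ball 0 1) \<and>
      (\<forall>p\<in>ball 0 1. (\<lambda>n. p ^ n * a n) sums f p) \<and>
      continuous_on (cball 0 1) f \<and>
      (\<forall>p. norm p \<le> 1 \<longrightarrow> norm (f p) < 1)"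
    and q: "norm q \<le> 1 / 3"
  show "summable (\<lambda>n. norm (q ^ n * a n)) \<and> (\<Sum>n. norm (q ^ n * a n)) < 1"
    using bohr_inequality[of a f q] f q by simp
qed (rule bohr_radius_sharp)

end
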